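(* Let $M>0$, $\mu\in(0,2]$, $\eta\in(0,\tfrac12)$. Fix an arbitrary sequence $\ell_1,\ldots,\ell_T$ of $\mu$-strongly convex differentiable losses on $[-\tfrac12M,\tfrac12M]$ such that $|\ell_t'|\le M$ on $[-\tfrac12M,\tfrac12M]$ for all $t$, and expert predictions $y_t(i)\in[-\tfrac12M,\tfrac12M]$, $t\in\{1,\dots,T\}$, $i\in\{1,\dots,K\}$. Fix any expert $i^\star$ and write $y_t^\star=y_t(i^\star)$. Provided $\max_i|y_t^\star-y_t(i)|\le M$ for all $t\ge1$, the predictions $\hat y_t$ of Algorithm 1 (defined in the context) run with inputs $M$ and $\eta$, $\kappa_t=1$ for all $t$, and feedback $g_t=\ell_t'(\hat y_t)$ satisfy $$\sum_{t=1}^T\big(\ell_t(\hat y_t)-\ell_t(y_t^\star)\big)\le\frac{M^2\log K}{\eta}-\Big(\frac{\mu}{2}-\eta\Big)\sum_{t=1}^T(\hat y_t-y_t^\star)^2 .$$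
   Context: A differentiable function $\ell$ is $\mu$-strongly convex on $[-\tfrac12M,\tfrac12M]$ if $\ell(y)-\ell(x)\le (y-x)\ell'(y)-\frac{\mu}{2}(x-y)^2$ for all $x,y$ in that interval. Algorithm 1 (prediction with expert advice, $K$ experts). Inputs $\eta$, $M>0$. Set $\gamma=\eta/M^2$ and $p_1(i)=1/K$ for all $i$. In each round $t=1,\ldots,T$: receive the expert predictions $y_t(1),\ldots,y_t(K)\in\mathbb{R}$; predict $\hat y_t=\sum_{i=1}^K p_t(i)y_t(i)$; receive feedback $g_t\in\mathbb{R}$ and $\kappa_t$; set $\tilde\ell_t(i)=\gamma(y_t(i)-\hat y_t)g_t+\kappa_{t-1}\big(\gamma(y_t(i)-\hat y_t)g_t\big)^2$ (with $\kappa_0=\kappa_1$); set $p_{t+1}(i)\propto\exp\!\big(-\kappa_t\sum_{s=1}^t\tilde\ell_s(i)\big)$, normalized to sum to one over $i$. Here $\log$ is the natural logarithm. *)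

theory Defs
  imports Complex_Main
begin

text \<open>
  First-order strong convexity, where \<open>f'\<close> plays the role of the derivative of \<open>f\<close> on \<open>S\<close>;
  that it really is the derivative has to be assumed separately.
\<close>

definition strongly_convex_on :: "real \<Rightarrow> real set \<Rightarrow> (real \<Rightarrow> real) \<Rightarrow> (real \<Rightarrow> real) \<Rightarrow> bool" where
  "strongly_convex_on \<mu> S f f' \<longleftrightarrow>
     (\<forall>x\<in>S. \<forall>y\<in>S. f y - f x \<le> (y - x) * f' y - \<mu> / 2 * (x - y)\<^sup>2)"

text \<open>
  Prediction with the advice of the experts \<open>1, \<dots>, K\<close>; rounds are numbered from 1.
  The parameter \<open>y t i\<close> is the prediction of expert \<open>i\<close> in round \<open>t\<close>. Feedback is revealed only
  after the learner has predicted and may depend on that prediction: \<open>G t z\<close> is the feedback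
  \<open>g\<^sub>t\<close> received if the learner predicts \<open>z\<close> in round \<open>t\<close>. An ordinary feedback sequence \<open>g\<close> is
  the case \<open>G = (\<lambda>t _. g t)\<close>. The values at round 0 have no meaning.
\<close>

definition prev_kappa :: "(nat \<Rightarrow> real) \<Rightarrow> nat \<Rightarrow> real" where
  "prev_kappa \<kappa> t = (if t \<le> 1 then \<kappa> 1 else \<kappa> (t - 1))"

function
  expert_weight :: "nat \<Rightarrow> real \<Rightarrow> real \<Rightarrow> (nat \<Rightarrow> real) \<Rightarrow> (nat \<Rightarrow> nat \<Rightarrow> real) \<Rightarrow>
    (nat \<Rightarrow> real \<Rightarrow> real) \<Rightarrow> nat \<Rightarrow> nat \<Rightarrow> real" and
  prediction :: "nat \<Rightarrow> real \<Rightarrow> real \<Rightarrow> (nat \<Rightarrow> real) \<Rightarrow> (nat \<Rightarrow> nat \<Rightarrow> real) \<Rightarrow>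
    (nat \<Rightarrow> real \<Rightarrow> real) \<Rightarrow> nat \<Rightarrow> real" and
  surrogate_loss :: "nat \<Rightarrow> real \<Rightarrow> real \<Rightarrow> (nat \<Rightarrow> real) \<Rightarrow> (nat \<Rightarrow> nat \<Rightarrow> real) \<Rightarrow>
    (nat \<Rightarrow> real \<Rightarrow> real) \<Rightarrow> nat \<Rightarrow> nat \<Rightarrow> real"
where
  "expert_weight K \<eta> M \<kappa> y G t i =
     (if t \<le> 1 then 1 / real K
      else exp (- \<kappa> (t - 1) * (\<Sum>s = 1..t - 1. surrogate_loss K \<eta> M \<kappa> y G s i)) /
        (\<Sum>j = 1..K. exp (- \<kappa> (t - 1) * (\<Sum>s = 1..t - 1. surrogate_loss K \<eta> M \<kappa> y G s j))))"
| "prediction K \<eta> M \<kappa> y G t = (\<Sum>i = 1..K. expert_weight K \<eta> M \<kappa> y G t i * y t i)"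
| "surrogate_loss K \<eta> M \<kappa> y G t i =
     (let yhat = prediction K \<eta> M \<kappa> y G t;
          r = \<eta> / M\<^sup>2 * (y t i - yhat) * G t yhat
      in r + prev_kappa \<kappa> t * r\<^sup>2)"
  by pat_completeness auto
termination
  by (relation "measure (\<lambda>x. case x of
        Inl (_, _, _, _, _, _, t, _) \<Rightarrow> 3 * t
      | Inr (Inl (_, _, _, _, _, _, t)) \<Rightarrow> 3 * t + 1
      | Inr (Inr (_, _, _, _, _, _, t, _)) \<Rightarrow> 3 * t + 2)") auto

declare expert_weight.simps [simp del] prediction.simps [simp del] surrogate_loss.simps [simp del]

end

theory Submission
  imports Defs
begin

text \<open>
  With constant learning rate 1, the total unnormalized weight
  \<open>W\<^sub>t = (\<Sum>i. exp (- (\<Sum>s\<le>t. surrogate loss of i)))\<close> is nonincreasing: writing \<open>r\<^sub>i\<close> for the scaled linear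
  loss of expert \<open>i\<close>, the inequality \<open>exp (- r - r\<^sup>2) \<le> 1 - r\<close> holds for \<open>r \<le> 1/2\<close>, and the mean of
  \<open>r\<^sub>i\<close> under the weights vanishes because the prediction is the weighted mean of the experts. As
  \<open>W\<^sub>0 = K\<close>, every expert has cumulative surrogate loss at least \<open>- ln K\<close>. Strong convexity bounds the
  true regret by the linearized one minus \<open>\<mu>/2\<close> times the squared distances, and the quadratic term
  of the surrogate loss adds at most \<open>\<eta>\<close> times the same squares.
\<close>

text \<open>The difference of the two sides vanishes at 0 and has derivative
  \<open>z * (1 + 2 * z) / (1 + z)\<close>. For z \<ge> -1/2 this has the sign of z, so 0 is a
  minimum.\<close>

lemma ln_one_plus_lower_bound:
  fixes x :: real
  assumes "- 1 / 2 \<le> x"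
  shows "x - x\<^sup>2 \<le> ln (1 + x)"
proof -
  define f where "f = (\<lambda>x::real. ln (1 + x) - x + x\<^sup>2)"
  have deriv: "(f has_real_derivative z * (1 + 2 * z) / (1 + z)) (at z)" if "- 1 / 2 \<le> z" for z
    unfolding f_def using that
    by (auto intro!: derivative_eq_intros simp: field_simps power2_eq_square)
  have "f 0 \<le> f x"
  proof (cases "0 \<le> x")
    case True
    show ?thesis
    proof (rule DERIV_nonneg_imp_nondecreasing[OF True])
      fix z :: real
      assume "0 \<le> z" "z \<le> x"
      then show "\<exists>d. DERIV f z :> d \<and> 0 \<le> d"
        by (intro exI[of _ "z * (1 + 2 * z) / (1 + z)"] conjI deriv) auto
    qed
  next
    case False
    then have "x \<le> 0" by simp
    then show ?thesis
    proof (rule DERIV_nonpos_imp_nonincreasing)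
      fix z :: real
      assume z: "x \<le> z" "z \<le> 0"
      \<comment> \<open>Here the bound -1/2 enters: it is where the factor \<open>1 + 2 * z\<close>
        changes sign.\<close>
      have "z * (1 + 2 * z) / (1 + z) \<le> 0"
        using z assms by (intro divide_nonpos_nonneg mult_nonpos_nonneg) auto
      then show "\<exists>d. DERIV f z :> d \<and> d \<le> 0"
        using deriv[of z] z assms by auto
    qed
  qed
  then show ?thesis by (simp add: f_def)
qed

lemma exp_minus_minus_square_le:
  fixes r :: real
  assumes "r \<le> 1 / 2"
  shows "exp (- (r + r\<^sup>2)) \<le> 1 - r"
proof -
  have "- (r + r\<^sup>2) \<le> ln (1 - r)"
    using ln_one_plus_lower_bound[of "- r"] assms by simp
  then show ?thesis
    using assms by (simp add: ln_ge_iff)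
qed

text \<open>In round 1 the sums of losses are empty, so the quotient is \<open>1 / real K\<close>.
  The uniform start thus fits the general formula, and the induction on the total weight needs no
  special first step.\<close>

lemma expert_weight_kappa_1:
  assumes "1 \<le> t"
  shows "expert_weight K \<eta> M (\<lambda>_. 1) y G t i =
    exp (- (\<Sum>s = 1..t - 1. surrogate_loss K \<eta> M (\<lambda>_. 1) y G s i)) /
    (\<Sum>j = 1..K. exp (- (\<Sum>s = 1..t - 1. surrogate_loss K \<eta> M (\<lambda>_. 1) y G s j)))"
  using assms by (cases "t = 1") (simp_all add: expert_weight.simps)

lemma expert_weight_nonneg: "0 \<le> expert_weight K \<eta> M \<kappa> y G t i"
  by (simp add: expert_weight.simps sum_nonneg)

lemma sum_expert_weight:
  assumes "1 \<le> K"
  shows "(\<Sum>i = 1..K. expert_weight K \<eta> M \<kappa> y G t i) = 1"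
proof -
  have "(\<Sum>i = 1..K. exp (f i) :: real) \<noteq> 0" for f
    using assms by (intro less_imp_neq[symmetric] sum_pos) auto
  then show ?thesis
    using assms by (cases "t \<le> 1") (simp_all add: expert_weight.simps flip: sum_divide_distrib)
qed

text \<open>The prediction is a convex combination of the experts. This keeps it where the losses
  are strongly convex and their derivatives bounded.\<close>

lemma prediction_in_interval:
  assumes "1 \<le> K" and "\<And>i. i \<in> {1..K} \<Longrightarrow> y t i \<in> {a..b}"
  shows "prediction K \<eta> M \<kappa> y G t \<in> {a..b}"
proof -
  let ?p = "expert_weight K \<eta> M \<kappa> y G t"
  have "(\<Sum>i = 1..K. ?p i * a) \<le> (\<Sum>i = 1..K. ?p i * y t i)"
    and "(\<Sum>i = 1..K. ?p i * y t i) \<le> (\<Sum>i = 1..K. ?p i * b)"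
    using assms(2) by (auto intro!: sum_mono mult_left_mono expert_weight_nonneg)
  then show ?thesis
    unfolding sum_distrib_right[symmetric] sum_expert_weight[OF assms(1)] prediction.simps
    by simp
qed

lemma mix_exp_surrogate_loss_le_1:
  fixes K \<eta> M y G t
  defines "yhat \<equiv> prediction K \<eta> M (\<lambda>_. 1) y G t"
  assumes "1 \<le> K"
    and "\<And>i. i \<in> {1..K} \<Longrightarrow> \<eta> / M\<^sup>2 * (y t i - yhat) * G t yhat \<le> 1 / 2"
  shows "(\<Sum>i = 1..K. expert_weight K \<eta> M (\<lambda>_. 1) y G t i *
    exp (- surrogate_loss K \<eta> M (\<lambda>_. 1) y G t i)) \<le> 1"
proof -
  let ?p = "expert_weight K \<eta> M (\<lambda>_. 1) y G t"
  define r where "r i = \<eta> / M\<^sup>2 * (y t i - yhat) * G t yhat" for i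
  have "(\<Sum>i = 1..K. ?p i * exp (- surrogate_loss K \<eta> M (\<lambda>_. 1) y G t i)) \<le>
      (\<Sum>i = 1..K. ?p i * (1 - r i))"
    using exp_minus_minus_square_le assms(3)
    by (intro sum_mono mult_left_mono expert_weight_nonneg)
      (simp add: surrogate_loss.simps prev_kappa_def Let_def r_def yhat_def)
  also have "\<dots> = (\<Sum>i = 1..K. ?p i) -
      \<eta> / M\<^sup>2 * G t yhat * ((\<Sum>i = 1..K. ?p i * y t i) - (\<Sum>i = 1..K. ?p i) * yhat)"
    unfolding r_def sum_distrib_right right_diff_distrib sum_subtractf[symmetric] sum_distrib_left
    by (intro sum.cong) (simp_all add: algebra_simps)
  also have "\<dots> = 1"
    unfolding sum_expert_weight[OF assms(2)] yhat_def prediction.simps by simp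
  finally show ?thesis .
qed

lemma cumulative_surrogate_loss_ge:
  fixes K \<eta> M y G T
  defines "yhat \<equiv> prediction K \<eta> M (\<lambda>_. 1) y G"
  assumes "i \<in> {1..K}"
    and small: "\<And>t j. t \<in> {1..T} \<Longrightarrow> j \<in> {1..K} \<Longrightarrow>
      \<eta> / M\<^sup>2 * (y t j - yhat t) * G t (yhat t) \<le> 1 / 2"
  shows "- ln (real K) \<le> (\<Sum>t = 1..T. surrogate_loss K \<eta> M (\<lambda>_. 1) y G t i)"
proof -
  let ?L = "\<lambda>t j. surrogate_loss K \<eta> M (\<lambda>_. 1) y G t j"
  define W where "W t = (\<Sum>j = 1..K. exp (- (\<Sum>s = 1..t. ?L s j)))" for t
  have K: "1 \<le> K" using assms(2) by simp
  have pos: "0 < W t" for t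
    unfolding W_def using K by (intro sum_pos) auto
  have "W t \<le> real K" if "t \<le> T" for t
    using that
  proof (induction t)
    case 0
    show ?case by (simp add: W_def)
  next
    case (Suc t)
    \<comment> \<open>The weights of round \<open>Suc t\<close> are the summands of
      \<open>W t\<close> divided by \<open>W t\<close>; the new loss multiplies each summand by one
      more exponential factor.\<close>
    have "W (Suc t) = W t * (\<Sum>j = 1..K. expert_weight K \<eta> M (\<lambda>_. 1) y G (Suc t) j * exp (- ?L (Suc t) j))"
      using pos[of t]
      by (simp add: expert_weight_kappa_1 exp_add[symmetric] sum_divide_distrib[symmetric]
          W_def[symmetric])
        (simp add: W_def exp_add)
    also have "\<dots> \<le> W t * 1"
      using Suc.prems K pos[of t] small
      by (intro mult_left_mono mix_exp_surrogate_loss_le_1) (auto simp: yhat_def)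
    also have "\<dots> \<le> real K"
      using Suc by simp
    finally show ?case .
  qed
  moreover have "exp (- (\<Sum>t = 1..T. ?L t i)) \<le> W T"
    unfolding W_def using assms(2)
    by (intro member_le_sum[of i _ "\<lambda>j. exp (- (\<Sum>t = 1..T. ?L t j))"]) auto
  ultimately have "exp (- (\<Sum>t = 1..T. ?L t i)) \<le> real K"
    by (meson order.refl order.trans)
  then have "- (\<Sum>t = 1..T. ?L t i) \<le> ln (real K)"
    using K by (simp add: ln_ge_iff)
  then show ?thesis by simp
qed

theorem corollary5:
  fixes M \<mu> \<eta> :: real
    and T K istar :: nat
    and l l' :: "nat \<Rightarrow> real \<Rightarrow> real"
    and y :: "nat \<Rightarrow> nat \<Rightarrow> real"
    and yhat :: "nat \<Rightarrow> real"
  assumes "M > 0" and "0 < \<mu>" and "\<mu> \<le> 2" and "0 < \<eta>" and "\<eta> < 1 / 2"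
    and "\<And>t x. t \<in> {1..T} \<Longrightarrow> x \<in> {- M / 2..M / 2} \<Longrightarrow>
           (l t has_real_derivative l' t x) (at x within {- M / 2..M / 2})"
    and "\<And>t. t \<in> {1..T} \<Longrightarrow> strongly_convex_on \<mu> {- M / 2..M / 2} (l t) (l' t)"
    and "\<And>t x. t \<in> {1..T} \<Longrightarrow> x \<in> {- M / 2..M / 2} \<Longrightarrow> \<bar>l' t x\<bar> \<le> M"
    and "\<And>t i. t \<in> {1..T} \<Longrightarrow> i \<in> {1..K} \<Longrightarrow> y t i \<in> {- M / 2..M / 2}"
    and "istar \<in> {1..K}"
    and "\<And>t. t \<in> {1..T} \<Longrightarrow> Max ((\<lambda>i. \<bar>y t istar - y t i\<bar>) ` {1..K}) \<le> M"
  defines "yhat \<equiv> prediction K \<eta> M (\<lambda>_. 1) y l'"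
  shows "(\<Sum>t = 1..T. l t (yhat t) - l t (y t istar)) \<le>
           M\<^sup>2 * ln (real K) / \<eta> - (\<mu> / 2 - \<eta>) * (\<Sum>t = 1..T. (yhat t - y t istar)\<^sup>2)"
proof -
  define g where "g t = l' t (yhat t)" for t
  define d where "d t = yhat t - y t istar" for t
  have K: "1 \<le> K" using assms(10) by simp
  have yhat_in: "yhat t \<in> {- M / 2..M / 2}" if "t \<in> {1..T}" for t
    unfolding yhat_def using K assms(9) that by (intro prediction_in_interval) auto
  have g_le: "\<bar>g t\<bar> \<le> M" if "t \<in> {1..T}" for t
    unfolding g_def using assms(8)[OF that yhat_in[OF that]] .
  \<comment> \<open>Distance and derivative are each at most M in absolute value, so the scaling by
    \<open>\<eta> / M\<^sup>2\<close> leaves at most \<eta>, which is below 1/2.\<close>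
  have small: "\<eta> / M\<^sup>2 * (y t j - yhat t) * l' t (yhat t) \<le> 1 / 2"
    if t: "t \<in> {1..T}" and j: "j \<in> {1..K}" for t j
  proof -
    have "\<bar>y t j - yhat t\<bar> \<le> M"
      using assms(9)[OF t j] yhat_in[OF t] by auto
    then have "\<bar>(y t j - yhat t) * g t\<bar> \<le> M * M"
      unfolding abs_mult using g_le[OF t] assms(1) by (intro mult_mono) auto
    then have "\<eta> / M\<^sup>2 * ((y t j - yhat t) * g t) \<le> \<eta> / M\<^sup>2 * M\<^sup>2"
      using assms(4) by (intro mult_left_mono) (auto simp: power2_eq_square)
    also have "\<dots> \<le> 1 / 2"
      using assms(1,5) by simp
    finally show ?thesis
      by (simp add: g_def mult.assoc)
  qed
  \<comment> \<open>The linear part carries a minus sign because \<open>d t\<close> is the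
    prediction minus the expert. In the square, \<open>(g t)\<^sup>2 \<le> M\<^sup>2\<close> cancels
    one factor \<open>1 / M\<^sup>2\<close>.\<close>
  have loss: "surrogate_loss K \<eta> M (\<lambda>_. 1) y l' t istar \<le> \<eta> / M\<^sup>2 * (\<eta> * (d t)\<^sup>2 - d t * g t)"
    if t: "t \<in> {1..T}" for t
  proof -
    have "(g t)\<^sup>2 \<le> M\<^sup>2"
      using g_le[OF t] assms(1) by (simp add: abs_le_square_iff[symmetric])
    then have "(\<eta> / M\<^sup>2)\<^sup>2 * (d t)\<^sup>2 * (g t)\<^sup>2 \<le> (\<eta> / M\<^sup>2)\<^sup>2 * (d t)\<^sup>2 * M\<^sup>2"
      by (intro mult_left_mono) auto
    also have "\<dots> = \<eta> / M\<^sup>2 * (\<eta> * (d t)\<^sup>2)"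
      using assms(1) by (simp add: power2_eq_square)
    finally have "(\<eta> / M\<^sup>2 * - d t * g t)\<^sup>2 \<le> \<eta> / M\<^sup>2 * (\<eta> * (d t)\<^sup>2)"
      by (simp add: power_mult_distrib power_divide)
    moreover have "surrogate_loss K \<eta> M (\<lambda>_. 1) y l' t istar =
        \<eta> / M\<^sup>2 * - d t * g t + (\<eta> / M\<^sup>2 * - d t * g t)\<^sup>2"
      by (simp add: surrogate_loss.simps prev_kappa_def Let_def yhat_def g_def d_def)
    ultimately show ?thesis
      by (simp add: right_diff_distrib mult.assoc)
  qed
  have "- ln (real K) \<le> (\<Sum>t = 1..T. surrogate_loss K \<eta> M (\<lambda>_. 1) y l' t istar)"
    using assms(10) small unfolding yhat_def by (rule cumulative_surrogate_loss_ge)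
  also have "\<dots> \<le> (\<Sum>t = 1..T. \<eta> / M\<^sup>2 * (\<eta> * (d t)\<^sup>2 - d t * g t))"
    using loss by (rule sum_mono)
  also have "\<dots> = \<eta> / M\<^sup>2 * (\<eta> * (\<Sum>t = 1..T. (d t)\<^sup>2) - (\<Sum>t = 1..T. d t * g t))"
    by (simp only: sum_subtractf[symmetric] sum_distrib_left)
  \<comment> \<open>Multiplying by \<open>M\<^sup>2 / \<eta>\<close> undoes the scaling of the
    losses and turns \<open>ln (real K)\<close> into the leading term of the bound.\<close>
  finally have linear: "(\<Sum>t = 1..T. d t * g t) \<le> M\<^sup>2 * ln (real K) / \<eta> + \<eta> * (\<Sum>t = 1..T. (d t)\<^sup>2)"
    using assms(1,4) by (simp add: field_simps)
  have "(\<Sum>t = 1..T. l t (yhat t) - l t (y t istar)) \<le> (\<Sum>t = 1..T. d t * g t - \<mu> / 2 * (d t)\<^sup>2)"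
  proof (rule sum_mono)
    fix t
    assume t: "t \<in> {1..T}"
    show "l t (yhat t) - l t (y t istar) \<le> d t * g t - \<mu> / 2 * (d t)\<^sup>2"
      \<comment> \<open>Strong convexity is applied with the derivative taken at the prediction,
        which is exactly the feedback \<open>g t\<close>.\<close>
      using assms(7)[OF t] assms(9)[OF t assms(10)] yhat_in[OF t]
      unfolding strongly_convex_on_def d_def g_def power2_commute[of "yhat t"] by blast
  qed
  also have "\<dots> = (\<Sum>t = 1..T. d t * g t) - \<mu> / 2 * (\<Sum>t = 1..T. (d t)\<^sup>2)"
    by (simp add: sum_subtractf sum_distrib_left)
  also have "\<dots> \<le> M\<^sup>2 * ln (real K) / \<eta> - (\<mu> / 2 - \<eta>) * (\<Sum>t = 1..T. (d t)\<^sup>2)"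
    using linear by (simp add: left_diff_distrib)
  finally show ?thesis
    unfolding d_def .
qed

end
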